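(* Let $f(X)$ be a polynomial with integer coefficients of degree $n\ge 3$, with $f(0)\neq 0$, and assume that its reciprocal $\tilde f(X)=X^nf(\frac1X)$ has no roots in the sector $S_{\tilde v,\frac{\pi}{n}}$ for some real number $\tilde v\in\left(0,\frac12\tan\frac{\pi}{2n}\right)$. If $f(m)$ is a prime number for some integer $m\in\left(\frac{1}{2\tilde v}-\delta,\frac{1}{2\tilde v}+\delta\right)$ with $$\delta=\sqrt{1+\frac{1}{4\tilde v^2}-\frac{1}{\tilde v\sin\frac{\pi}{n}}},$$ then $f$ is irreducible over $\mathbb{Q}$.
   Context: For real numbers $v,\theta$ with $0<\theta<\pi$, define the open sector $S_{v,\theta}=\{z=v+\rho e^{i\varphi}\in\mathbb{C}:\rho>0,\ |\varphi|<\theta\}$ (with $\varphi$ real). *)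

theory Defs
  imports "HOL-Computational_Algebra.Computational_Algebra"
begin

(* Meant for 0 < \<theta> < pi, as in the source; cis \<phi> is exp (\<i> \<phi>). *)
definition open_sector :: "real \<Rightarrow> real \<Rightarrow> complex set" where
  "open_sector v \<theta> =
     {z. \<exists>\<rho> \<phi>. \<rho> > 0 \<and> \<bar>\<phi>\<bar> < \<theta> \<and> z = complex_of_real v + complex_of_real \<rho> * cis \<phi>}"

end

theory Submission imports Defs begin

text \<open>
  Inversion \<open>z \<mapsto> 1/z\<close> carries the sector at \<open>v\<close> of half-angle \<open>\<theta> = \<pi>/n\<close> to the lens cut out by the
  two disks of radius \<open>R = 1/(2 v sin \<theta>)\<close> centred at \<open>(1 \<plusminus> \<i> cot \<theta>)/(2v)\<close>, whose boundary circles
  pass through \<open>0\<close> and \<open>1/v\<close>. The roots of \<open>f\<close> therefore lie outside this lens. The bound on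
  \<open>m\<close> says exactly that the distance of \<open>m\<close> from the centres is less than \<open>R - 1\<close>, so all roots of
  \<open>f\<close> have distance greater than \<open>1\<close> from \<open>m\<close>. Hence every nonconstant integral factor of \<open>f\<close> has
  absolute value greater than \<open>1\<close> at \<open>m\<close>, and a prime value leaves room for only one such factor.
\<close>

lemma map_poly_of_int_mult:
  "map_poly (of_int :: int \<Rightarrow> 'a::{comm_ring_1,ring_char_0}) (p * q) =
     map_poly of_int p * map_poly of_int q"
  by (intro poly_eqI) (simp add: coeff_map_poly coeff_mult)

lemma poly_map_poly_of_int [simp]:
  "poly (map_poly (of_int :: int \<Rightarrow> 'a::{comm_ring_1,ring_char_0}) p) (of_int x) = of_int (poly p x)"
  by (induction p) (simp_all add: map_poly_pCons)

lemma degree_map_poly_of_int [simp]: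
  "degree (map_poly (of_int :: int \<Rightarrow> 'a::{comm_ring_1,ring_char_0}) p) = degree p"
  by (rule degree_map_poly) simp

lemma reflect_poly_map_poly_of_int:
  "reflect_poly (map_poly (of_int :: int \<Rightarrow> 'a::{comm_ring_1,ring_char_0}) p) =
     map_poly of_int (reflect_poly p)"
  by (intro poly_eqI) (simp add: coeff_map_poly coeff_reflect_poly)

lemma rat_poly_clear_denominators:
  fixes p :: "rat poly"
  obtains d :: int and q :: "int poly" where "d \<noteq> 0" "smult (of_int d) p = map_poly of_int q"
proof -
  have "\<exists>d q. d \<noteq> 0 \<and> smult (of_int d) p = map_poly of_int q"
  proof (induction p)
    case 0
    show ?case by (intro exI[of _ 1] exI[of _ 0]) simp
  next
    case (pCons c p)
    then obtain d q where d: "d \<noteq> 0" and q: "smult (of_int d) p = map_poly of_int q" by blast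
    obtain a b :: int where b: "b > 0" and c: "c = of_int a / of_int b"
      by (metis Fract_of_int_quotient Rat_cases)
    have "smult (of_int (b * d)) (pCons c p) =
        pCons (of_int (a * d)) (smult (of_int b) (smult (of_int d) p))"
      using b c by simp
    also have "\<dots> = map_poly of_int (pCons (a * d) (smult b q))"
      by (simp add: q map_poly_pCons map_poly_smult)
    finally show ?case using d b by (intro exI[of _ "b * d"]) auto
  qed
  then show thesis using that by blast
qed

text \<open>This is Gauss's lemma: after denominators are cleared in a rational factorization,
  multiplicativity of the content yields an integral one with factors of the same degrees. The
  premise \<open>fact\<close> speaks of degrees because \<open>f\<close> may have a nontrivial
  content, whose constant factors become units over the rationals.\<close>

lemma irreducible_map_poly_rat_of_int:
  fixes f :: "int poly"
  assumes deg: "degree f > 0"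
    and fact: "\<And>g h. f = g * h \<Longrightarrow> degree g = 0 \<or> degree h = 0"
  shows "irreducible (map_poly rat_of_int f)"
proof (rule irreducibleI)
  let ?F = "map_poly rat_of_int f"
  show "?F \<noteq> 0" using deg by (metis degree_0 degree_map_poly_of_int less_irrefl)
  show "\<not> is_unit ?F" using deg \<open>?F \<noteq> 0\<close> by (simp add: is_unit_iff_degree)
  fix a b assume ab: "?F = a * b"
  with \<open>?F \<noteq> 0\<close> have nz: "a \<noteq> 0" "b \<noteq> 0" by auto
  obtain c p where c: "c \<noteq> 0" and p: "smult (of_int c) a = map_poly of_int p"
    by (rule rat_poly_clear_denominators)
  obtain d q where d: "d \<noteq> 0" and q: "smult (of_int d) b = map_poly of_int q"
    by (rule rat_poly_clear_denominators)
  have "map_poly rat_of_int (p * q) = map_poly of_int (smult (c * d) f)"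
    unfolding map_poly_of_int_mult p[symmetric] q[symmetric]
    by (simp add: map_poly_smult ab mult_ac)
  then have pq: "p * q = smult (c * d) f"
    by (simp add: poly_eq_iff coeff_map_poly del: of_int_mult)
  have cont: "content p * content q = \<bar>c * d\<bar> * content f"
    using arg_cong[OF pq, of content] by (simp add: content_mult)
  have "smult (c * d) f = smult (content p) (primitive_part p) * smult (content q) (primitive_part q)"
    by (simp only: content_times_primitive_part pq)
  also have "\<dots> = smult (content p * content q) (primitive_part p * primitive_part q)"
    by (simp del: content_times_primitive_part add: mult_ac)
  \<comment> \<open>The contents give only \<open>\<bar>c * d\<bar>\<close>; moving the sign into
    the other scalar exposes \<open>c * d\<close> itself, which then cancels.\<close>
  also have "\<dots> = smult (c * d) (smult (sgn (c * d) * content f) (primitive_part p * primitive_part q))"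
    by (simp del: content_times_primitive_part add: cont abs_sgn mult_ac)
  finally have "f = smult (sgn (c * d) * content f) (primitive_part p) * primitive_part q"
    using c d by (simp add: poly_eq_iff)
  then have "degree (smult (sgn (c * d) * content f) (primitive_part p)) = 0 \<or>
      degree (primitive_part q) = 0"
    by (rule fact)
  then have "degree p = 0 \<or> degree q = 0"
    using c d deg by (auto simp: sgn_0_0 split: if_splits)
  moreover have "degree p = degree a" "degree q = degree b"
    using arg_cong[OF p, of degree] arg_cong[OF q, of degree] c d by auto
  ultimately show "is_unit a \<or> is_unit b"
    using nz by (auto simp: is_unit_iff_degree)
qed

text \<open>The value at \<open>x\<close> has modulus \<open>cmod (lead_coeff p)\<close> times the
  product of the distances from \<open>x\<close> to the roots, counted with multiplicity; positive
  degree makes this product nonempty.\<close>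

lemma norm_poly_gt_1:
  fixes p :: "complex poly"
  assumes deg: "degree p > 0" and lead: "cmod (lead_coeff p) \<ge> 1"
    and roots: "\<And>z. poly p z = 0 \<Longrightarrow> cmod (x - z) > 1"
  shows "cmod (poly p x) > 1"
proof -
  obtain r where r: "smult (lead_coeff p) (\<Prod>i<degree p. [:- r i, 1:]) = p"
    by (rule complex_poly_decompose')
  have val: "poly p y = lead_coeff p * (\<Prod>i<degree p. y - r i)" for y
    by (subst r[symmetric]) (simp add: poly_prod)
  have *: "1 < cmod (x - r i)" if "i < degree p" for i
    using that by (intro roots) (auto simp: val)
  have "1 < (\<Prod>i<degree p. cmod (x - r i))"
    using deg * by (intro less_1_prod) auto
  also have "\<dots> \<le> cmod (lead_coeff p) * \<dots>"
    using mult_right_mono[OF lead, of "\<Prod>i<degree p. cmod (x - r i)"] by (simp add: prod_nonneg)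
  also have "\<dots> = cmod (poly p x)" by (simp add: val norm_mult prod_norm)
  finally show ?thesis .
qed

lemma irreducible_if_prime_value_far_from_roots:
  fixes f :: "int poly" and m :: int
  assumes deg: "degree f > 0" and prime: "prime (poly f m)"
    and roots: "\<And>z. poly (map_poly complex_of_int f) z = 0 \<Longrightarrow> cmod (of_int m - z) > 1"
  shows "irreducible (map_poly rat_of_int f)"
proof (rule irreducible_map_poly_rat_of_int[OF deg])
  fix g h assume f: "f = g * h"
  have not_unit: "\<bar>poly p m\<bar> > 1" if "degree p > 0" "p dvd f" for p
  proof -
    \<comment> \<open>Integrality enters here: a nonzero integer has absolute value at least 1. The
      roots of the factor \<open>p\<close> are among those of \<open>f\<close>.\<close>
    have "lead_coeff p \<noteq> 0" using that(1) by auto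
    then have "cmod (of_int (lead_coeff p)) \<ge> 1" by (simp del: leading_coeff_0_iff)
    then have "cmod (poly (map_poly complex_of_int p) (of_int m)) > 1"
      using that by (intro norm_poly_gt_1 roots) (auto simp: coeff_map_poly map_poly_of_int_mult)
    then show ?thesis by simp
  qed
  have "prime (poly g m * poly h m)" using prime f by simp
  then have "\<bar>poly g m\<bar> = 1 \<or> \<bar>poly h m\<bar> = 1"
    by (metis prime_elem_iff_prime_abs irreducible_multD prime_elem_imp_irreducible prime_imp_prime_elem
        zdvd1_eq)
  then show "degree g = 0 \<or> degree h = 0"
    using not_unit[of g] not_unit[of h] f by (cases "degree g = 0"; cases "degree h = 0") auto
qed

text \<open>For acute \<theta> the sector is a cone lying to the right of \<open>v\<close>, so the
  polar angle of \<open>z - v\<close> is the arctangent of its slope \<open>t\<close>.\<close>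

lemma open_sectorI:
  assumes "0 < \<theta>" "\<theta> < pi / 2" and cone: "\<bar>Im z\<bar> * cos \<theta> < (Re z - v) * sin \<theta>"
  shows "z \<in> open_sector v \<theta>"
proof -
  define x where "x = Re z - v"
  define t where "t = Im z / x"
  have cs: "cos \<theta> > 0" "sin \<theta> > 0"
    using assms by (auto intro: cos_gt_zero_pi sin_gt_zero)
  have "0 < x * sin \<theta>"
    using cone cs unfolding x_def by (smt (verit) mult_nonneg_nonneg)
  then have x: "x > 0" using cs by (simp add: zero_less_mult_iff)
  have "\<bar>t\<bar> < tan \<theta>"
    using cone x cs by (simp add: t_def x_def[symmetric] tan_def abs_divide field_simps)
  then have "\<bar>arctan t\<bar> < arctan (tan \<theta>)"
    by (metis abs_less_iff arctan_less_iff arctan_minus minus_less_iff)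
  then have \<phi>: "\<bar>arctan t\<bar> < \<theta>" using assms by (simp add: arctan_tan)
  have s: "sqrt (1 + t\<^sup>2) > 0" by (simp add: add_pos_nonneg)
  have "z = of_real v + of_real (x * sqrt (1 + t\<^sup>2)) * cis (arctan t)"
    using s x by (simp add: complex_eq_iff cos_arctan sin_arctan) (simp add: x_def t_def)
  with s x \<phi> show ?thesis
    unfolding open_sector_def by (intro CollectI exI[of _ "x * sqrt (1 + t\<^sup>2)"] exI[of _ "arctan t"]) auto
qed

text \<open>Both circles pass through 0, so inversion turns them into lines, namely those bounding
  the sector. In coordinates, each disk condition becomes linear in \<open>x\<close>,
  \<open>y\<close> and \<open>N = \<bar>z\<bar>^2\<close>, and division by \<open>N\<close> gives
  the cone condition for \<open>inverse z\<close>.\<close>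

lemma inverse_in_open_sector:
  fixes z :: complex
  assumes \<theta>: "0 < \<theta>" "\<theta> < pi / 2" and v: "0 < v" and z: "z \<noteq> 0"
    and disks: "\<And>s. s \<in> {-1, 1} \<Longrightarrow>
      cmod (z - Complex (1 / (2 * v)) (s * cot \<theta> / (2 * v))) < 1 / (2 * v * sin \<theta>)"
  shows "inverse z \<in> open_sector v \<theta>"
proof (rule open_sectorI[OF \<theta>])
  define x y where "x = Re z" and "y = Im z"
  define N where "N = x\<^sup>2 + y\<^sup>2"
  have sn: "sin \<theta> > 0" using \<theta> by (auto intro: sin_gt_zero)
  have N: "N > 0" using z by (simp add: N_def x_def y_def complex_eq_iff sum_power2_gt_zero_iff)
  have ineq: "v * N * sin \<theta> < x * sin \<theta> + s * y * cos \<theta>" if s: "s \<in> {-1, 1}" for s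
  proof -
    have s2: "s\<^sup>2 = 1" using s by auto
    have "(cmod (z - Complex (1 / (2 * v)) (s * cot \<theta> / (2 * v))))\<^sup>2 < (1 / (2 * v * sin \<theta>))\<^sup>2"
      by (rule power_strict_mono[OF disks[OF s]]) auto
    then have "(x - 1 / (2 * v))\<^sup>2 + (y - s * cot \<theta> / (2 * v))\<^sup>2 < (1 / (2 * v * sin \<theta>))\<^sup>2"
      by (simp add: cmod_power2 x_def y_def)
    \<comment> \<open>Scaling by the inverse squared radius clears denominators; the constant term
      then becomes \<open>sin^2 + cos^2 = 1\<close> and cancels the right-hand side.\<close>
    then have "(2 * v * sin \<theta>)\<^sup>2 * ((x - 1 / (2 * v))\<^sup>2 + (y - s * cot \<theta> / (2 * v))\<^sup>2) < 1"
      using v sn by (simp add: field_simps power_divide)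
    moreover have "(2 * v * sin \<theta>)\<^sup>2 * ((x - 1 / (2 * v))\<^sup>2 + (y - s * cot \<theta> / (2 * v))\<^sup>2) =
        (2 * v * x * sin \<theta> - sin \<theta>)\<^sup>2 + (2 * v * y * sin \<theta> - s * cos \<theta>)\<^sup>2"
      unfolding distrib_left power_mult_distrib[symmetric] using v sn
      by (intro arg_cong2[of _ _ _ _ "(+)"] arg_cong[of _ _ "\<lambda>x. x\<^sup>2"])
        (auto simp: cot_def field_simps)
    moreover have "\<dots> = 4 * v * sin \<theta> * (v * N * sin \<theta> - x * sin \<theta> - s * y * cos \<theta>)
        + ((sin \<theta>)\<^sup>2 + s\<^sup>2 * (cos \<theta>)\<^sup>2)"
      by (simp add: N_def power2_eq_square algebra_simps)
    ultimately have "4 * v * sin \<theta> * (v * N * sin \<theta> - x * sin \<theta> - s * y * cos \<theta>) < 0"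
      by (simp add: s2)
    then show ?thesis using v sn by (simp add: mult_less_0_iff)
  qed
  \<comment> \<open>The disk with \<open>s = -1\<close> gives the bound for
    \<open>y \<ge> 0\<close>, the one with \<open>s = 1\<close> the bound for negative
    \<open>y\<close>.\<close>
  have "\<bar>y\<bar> * cos \<theta> < (x - v * N) * sin \<theta>"
    using ineq[of 1] ineq[of "-1"] by (cases "y \<ge> 0") (simp_all add: algebra_simps)
  then have "\<bar>y\<bar> * cos \<theta> / N < (x - v * N) * sin \<theta> / N"
    using N by (rule divide_strict_right_mono)
  moreover have "Re (inverse z) - v = (x - v * N) / N" "\<bar>Im (inverse z)\<bar> = \<bar>y\<bar> / N"
    using N by (simp_all add: x_def y_def diff_divide_distrib abs_divide flip: N_def[unfolded x_def y_def])
  ultimately show "\<bar>Im (inverse z)\<bar> * cos \<theta> < (Re (inverse z) - v) * sin \<theta>"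
    by simp
qed

lemma norm_gt_1_if_inverse_notin_open_sector:
  fixes z :: complex and v \<theta> x :: real
  assumes \<theta>: "0 < \<theta>" "\<theta> < pi / 2" and v: "0 < v" "v < 1 / 2 * tan (\<theta> / 2)" and z: "z \<noteq> 0"
    and x: "\<bar>x - 1 / (2 * v)\<bar> < sqrt (1 + 1 / (4 * v ^ 2) - 1 / (v * sin \<theta>))"
    and notin: "inverse z \<notin> open_sector v \<theta>"
  shows "cmod (of_real x - z) > 1"
proof (rule ccontr)
  assume far: "\<not> ?thesis"
  define R where "R = 1 / (2 * v * sin \<theta>)"
  have sn: "sin \<theta> > 0" using \<theta> by (auto intro: sin_gt_zero)
  have "0 < cos (\<theta> / 2)" using \<theta> by (intro cos_gt_zero_pi) auto
  \<comment> \<open>This half-angle identity turns the bound on \<open>v\<close> into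
    \<open>2 * v * sin \<theta> < 1 - cos \<theta> < 1\<close>, hence \<open>R > 1\<close>.
    Positivity of \<open>R - 1\<close> is what later allows squares to be compared.\<close>
  then have "tan (\<theta> / 2) * sin \<theta> = 1 - cos \<theta>"
    using sin_double[of "\<theta> / 2"] cos_double_sin[of "\<theta> / 2"]
    by (simp add: tan_def power2_eq_square)
  moreover have "cos \<theta> > 0" using \<theta> by (intro cos_gt_zero_pi) auto
  moreover have "2 * v * sin \<theta> < tan (\<theta> / 2) * sin \<theta>" using v sn by simp
  ultimately have "R > 1" using v sn by (simp add: R_def)
  \<comment> \<open>Since \<open>sqrt\<close> is negative at negative arguments, this excludes a
    negative radicand, and squaring the bound on \<open>x\<close> recovers the radicand
    itself.\<close>
  have "0 \<le> sqrt (1 + 1 / (4 * v ^ 2) - 1 / (v * sin \<theta>))"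
    using x by linarith
  then have "(x - 1 / (2 * v))\<^sup>2 < 1 + 1 / (4 * v ^ 2) - 1 / (v * sin \<theta>)"
    using power_strict_mono[OF x, of 2] by simp
  moreover have "(R - 1)\<^sup>2 - (cot \<theta> / (2 * v))\<^sup>2 = 1 + 1 / (4 * v ^ 2) - 1 / (v * sin \<theta>)"
  proof -
    have "R\<^sup>2 - (cot \<theta> / (2 * v))\<^sup>2 = (1 - (cos \<theta>)\<^sup>2) / (4 * v\<^sup>2 * (sin \<theta>)\<^sup>2)"
      by (simp add: R_def cot_def power_divide power_mult_distrib diff_divide_distrib)
    also have "\<dots> = 1 / (4 * v\<^sup>2)"
      using sn v by (simp add: sin_squared_eq[symmetric])
    finally show ?thesis by (simp add: R_def power2_diff)
  qed
  ultimately have dist: "(x - 1 / (2 * v))\<^sup>2 + (cot \<theta> / (2 * v))\<^sup>2 < (R - 1)\<^sup>2" by simp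
  have "inverse z \<in> open_sector v \<theta>"
  proof (rule inverse_in_open_sector[OF \<theta> v(1) z])
    fix s :: real assume "s \<in> {-1, 1}"
    let ?c = "Complex (1 / (2 * v)) (s * cot \<theta> / (2 * v))"
    have "(cmod (of_real x - ?c))\<^sup>2 < (R - 1)\<^sup>2"
      using \<open>s \<in> {-1, 1}\<close> dist by (auto simp: cmod_power2)
    then have "cmod (of_real x - ?c) < R - 1"
      by (rule power2_less_imp_less) (use \<open>R > 1\<close> in simp)
    \<comment> \<open>If \<open>z\<close> were within distance 1 of \<open>x\<close>, the triangle
      inequality would put it in both disks, within \<open>1 + (R - 1)\<close> of each
      centre.\<close>
    then have "cmod (z - ?c) < R"
      using far norm_triangle_ineq[of "z - of_real x" "of_real x - ?c"]
      by (simp add: norm_minus_commute)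
    then show "cmod (z - ?c) < 1 / (2 * v * sin \<theta>)" by (simp add: R_def)
  qed
  with notin show False by contradiction
qed

theorem theorem3p12:
  fixes f :: "int poly" and n :: nat and v \<delta> :: real and m :: int
  assumes "degree f = n" and "n \<ge> 3" and "poly f 0 \<noteq> 0"
    and "0 < v" and "v < 1 / 2 * tan (pi / (2 * real n))"
    and "\<forall>z \<in> open_sector v (pi / real n).
           poly (map_poly complex_of_int (reflect_poly f)) z \<noteq> 0"
    and "\<delta> = sqrt (1 + 1 / (4 * v ^ 2) - 1 / (v * sin (pi / real n)))"
    and "real_of_int m \<in> {1 / (2 * v) - \<delta> <..< 1 / (2 * v) + \<delta>}"
    and "prime (poly f m)"
  shows "irreducible (map_poly rat_of_int f)"
proof (rule irreducible_if_prime_value_far_from_roots)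
  show "degree f > 0" "prime (poly f m)" using assms by auto
  fix z assume root: "poly (map_poly complex_of_int f) z = 0"
  have z: "z \<noteq> 0"
    using root \<open>poly f 0 \<noteq> 0\<close> poly_map_poly_of_int[of f 0, where 'a = complex] by auto
  have "poly (map_poly complex_of_int (reflect_poly f)) (inverse z) = 0"
    unfolding reflect_poly_map_poly_of_int[symmetric] using z root
    by (simp add: poly_reflect_poly_nz)
  then have "inverse z \<notin> open_sector v (pi / real n)" using assms(6) by blast
  \<comment> \<open>The degree bound makes the half-angle acute, as the cone description of the
    sector demands.\<close>
  moreover have "pi / real n < pi / 2" "0 < pi / real n"
    using \<open>n \<ge> 3\<close> by (auto simp: field_simps)
  moreover have "v < 1 / 2 * tan (pi / real n / 2)" using assms(5) by (simp add: mult.commute)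
  moreover have "\<bar>real_of_int m - 1 / (2 * v)\<bar> < sqrt (1 + 1 / (4 * v ^ 2) - 1 / (v * sin (pi / real n)))"
    using assms(8) unfolding assms(7) by auto
  ultimately show "cmod (of_int m - z) > 1"
    using norm_gt_1_if_inverse_notin_open_sector[of "pi / real n" v z "of_int m"] z \<open>0 < v\<close>
    by simp
qed

end
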